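(* Let $s\ge1$, $R>0$, and let $f:\mathbb{R}^{\ge0}\to\mathbb{R}^{\ge0}$ be a non-increasing function with $f(x)>0$ for $0\le x<R$ and $f(x)=0$ for $x\ge R$. Consider states $X_i(n)\in\mathbb{R}$, $1\le i\le s$, evolving by $$X_i(n+1)=\sum_{j=1}^s a_{ij}(n)X_j(n),\qquad a_{ij}(n)=\frac{f(|X_i(n)-X_j(n)|)}{\sum_{k=1}^s f(|X_i(n)-X_k(n)|)} .$$ Then the transition chain $(A_n)$, $A_n=(a_{ij}(n))_{1\le i,j\le s}$, is class-ergodic, i.e., unconditional multiple consensus occurs: $\lim_{n\to\infty}X_i(n)$ exists for every $i$, no matter at what instant or values the states are initialized. (The Krause model is the case $f(x)=1$ for $0\le x<R$ and $f(x)=0$ otherwise.)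
   Context: The chain $(A_n)$ is generated by the trajectory of the states. For $n>k\ge 0$ let $A(n,k)=A_{n-1}A_{n-2}\cdots A_k$. A chain $(A_n)$ of row stochastic matrices (nonnegative entries, each row summing to $1$) is class-ergodic if for every $k\ge 0$ the limit $\lim_{n\to\infty}A(n,k)$ exists and can be relabeled (by renumbering the indices $1,\dots,s$) as a block diagonal matrix with constant rows, i.e. the rows within each diagonal block are identical.
   Formalization: Class-ergodicity is corrected: one renumbering into blocks serves all k, rows of lim A(n,k) agree within blocks for every k, but entries outside the blocks only tend to 0 as k→∞; exact block diagonality for every k is false for these chains. *)

theory Defs
  imports "HOL-Analysis.Analysis"
begin

definition row_stochastic :: "real^'s^'s \<Rightarrow> bool" where
  "row_stochastic M \<longleftrightarrow> (\<forall>i j. 0 \<le> M $ i $ j) \<and> (\<forall>i. (\<Sum>j\<in>UNIV. M $ i $ j) = 1)"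

text \<open>\<open>backward_product A n k\<close> is $A(n,k) = A_{n-1} A_{n-2} \cdots A_k$ for $n > k$
  (and the identity matrix for $n \le k$).\<close>

primrec backward_product :: "(nat \<Rightarrow> real^'s^'s) \<Rightarrow> nat \<Rightarrow> nat \<Rightarrow> real^'s^'s" where
  "backward_product A 0 k = mat 1"
| "backward_product A (Suc n) k =
     (if k \<le> n then A n ** backward_product A n k else mat 1)"

text \<open>Class-ergodicity. \<open>L k\<close> is $\lim_n A(n,k)$, \<open>\<sigma>\<close> renumbers the indices by $1, \dots, s$, and
  the diagonal blocks are the level sets of the monotone function \<open>b\<close>, hence intervals of labels.
  Rows of the same block are identical in every \<open>L k\<close>.

  The entries outside the diagonal blocks are required to vanish as \<open>k \<rightarrow> \<infinity>\<close>, not for each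
  single \<open>k\<close>. Exact block diagonality of each \<open>L k\<close> implies this condition, but it fails for the
  state-dependent chains considered here. Take $R = 1$, $f = 1$ on $[0,1/2]$, $f = 1/10$ on
  $(1/2,1)$, $f = 0$ on $[1,\infty)$ and $X(0) = (0, 1/2, 7/5)$. Then
  $X(1) = (1/4, 32/105, 29/22)$, so that agent 3 interacts with nobody from time 1 on, and
  $\lim_n A(n,0)$ has the rows $(41/84, 41/84, 1/42)$ (twice) and $(0, 1/11, 10/11)$. The nonzero
  entry at $(2,3)$ puts 2 and 3 into one block, although their rows differ.\<close>

definition class_ergodic :: "(nat \<Rightarrow> real^'s^'s) \<Rightarrow> bool" where
  "class_ergodic A \<longleftrightarrow>
     (\<forall>n. row_stochastic (A n)) \<and>
     (\<exists>L (\<sigma> :: nat \<Rightarrow> 's) (b :: nat \<Rightarrow> nat).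
        (\<forall>k. (\<lambda>n. backward_product A n k) \<longlonglongrightarrow> L k) \<and>
        bij_betw \<sigma> {1..CARD('s)} UNIV \<and> mono_on {1..CARD('s)} b \<and>
        (\<forall>k. \<forall>i\<in>{1..CARD('s)}. \<forall>j\<in>{1..CARD('s)}.
           b i = b j \<longrightarrow> L k $ \<sigma> i = L k $ \<sigma> j) \<and>
        (\<forall>i\<in>{1..CARD('s)}. \<forall>j\<in>{1..CARD('s)}.
           b i \<noteq> b j \<longrightarrow> (\<lambda>k. L k $ \<sigma> i $ \<sigma> j) \<longlonglongrightarrow> 0))"

text \<open>Unconditional multiple consensus for a given chain: every solution of
  $y(n+1) = A_n y(n)$ converges, whatever its initial instant \<open>k\<close> and initial value \<open>y k\<close>.\<close>

definition unconditional_multiple_consensus :: "(nat \<Rightarrow> real^'s^'s) \<Rightarrow> bool" where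
  "unconditional_multiple_consensus A \<longleftrightarrow>
     (\<forall>k y. (\<forall>n\<ge>k. y (Suc n) = A n *v y n) \<longrightarrow> (\<forall>i. convergent (\<lambda>n. y n $ i)))"

definition transition_matrix :: "(real \<Rightarrow> real) \<Rightarrow> real^'s \<Rightarrow> real^'s^'s" where
  "transition_matrix f x =
     (\<chi> i j. f \<bar>x $ i - x $ j\<bar> / (\<Sum>k\<in>UNIV. f \<bar>x $ i - x $ k\<bar>))"

definition evolves_from :: "nat \<Rightarrow> (real \<Rightarrow> real) \<Rightarrow> (nat \<Rightarrow> real^'s) \<Rightarrow> bool" where
  "evolves_from n0 f X \<longleftrightarrow> (\<forall>n\<ge>n0. \<forall>i.
     X (Suc n) $ i = (\<Sum>j\<in>UNIV. transition_matrix f (X n) $ i $ j * X n $ j))"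

end

theory Submission
  imports Defs
begin

text \<open>Every matrix \<open>transition_matrix f x\<close> has diagonal entries at least $\delta = 1/s$ and satisfies
  $a_{ij} \le C a_{ji}$ with $C = s$, because $f$ is non-increasing and all normalising sums lie
  between $f(0)$ and $s f(0)$. Class-ergodicity holds for every such chain. Let $F_p(y)$ be the sum
  of the $p$ smallest entries of $y$. Write $g_l$ for the $l$-th gap between consecutive sorted
  entries of $y$ and $c_l$ for the total weight from the $l$ smallest entries to the others. Then
  $$F_p(Ay) - F_p(y) \ge \delta g_p c_p - C \sum_{l<p} g_l c_l,$$
  so $\sum_p q^p F_p$ with small $q$ increases by at least a constant times
  $\sum_{i,j} a_{ij} |y_i - y_j|$. As it is bounded along solutions, these increments are summable.
  Hence every solution converges, and $i$ and $j$ have the same limit whenever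
  $\sum_n a_{ij}(n) = \infty$. The blocks are the classes of indices whose rows agree in all limits;
  the total weight exchanged between different classes is finite, which makes the off-block entries
  vanish.\<close>

section \<open>Cut and gap estimates for one balanced matrix in sorted coordinates\<close>

text \<open>Summation by parts. The values \<open>u\<close> below the top one enter only through
  gaps, so two weightings of the same total can be compared gap by gap through their cumulative
  masses.\<close>

lemma sum_by_gaps:
  fixes u w :: "nat \<Rightarrow> real"
  assumes "N \<ge> 1"
  shows "(\<Sum>j\<in>{1..N}. w j * u j)
    = u N * (\<Sum>j\<in>{1..N}. w j) - (\<Sum>l\<in>{1..<N}. (u (Suc l) - u l) * (\<Sum>j\<in>{1..l}. w j))"
  using assms
proof (induction N rule: dec_induct)
  case base
  then show ?case by simp
next
  case (step N)
  then show ?case by (simp add: atLeastLessThanSuc algebra_simps)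
qed

context
  fixes B :: "nat \<Rightarrow> nat \<Rightarrow> real" and N :: nat and \<delta> C :: real
  assumes nonneg: "\<And>i j. i \<in> {1..N} \<Longrightarrow> j \<in> {1..N} \<Longrightarrow> 0 \<le> B i j"
    and rowsum: "\<And>i. i \<in> {1..N} \<Longrightarrow> (\<Sum>j\<in>{1..N}. B i j) = 1"
    and diag: "\<And>i. i \<in> {1..N} \<Longrightarrow> \<delta> \<le> B i i"
    and balanced: "\<And>i j. i \<in> {1..N} \<Longrightarrow> j \<in> {1..N} \<Longrightarrow> B i j \<le> C * B j i"
    and \<delta>: "0 < \<delta>" "\<delta> \<le> 1" and C: "0 < C"
begin

lemma low_mass:
  assumes "l \<le> N" "i \<in> {1..N}"
  shows "0 \<le> (\<Sum>j\<in>{1..l}. B i j)"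
    and "(\<Sum>j\<in>{1..l}. B i j) + (\<Sum>j\<in>{Suc l..N}. B i j) = 1"
    and "(\<Sum>j\<in>{1..l}. B i j) \<le> 1"
    and "l < i \<Longrightarrow> (\<Sum>j\<in>{1..l}. B i j) \<le> 1 - \<delta>"
proof -
  show "0 \<le> (\<Sum>j\<in>{1..l}. B i j)"
    using assms by (intro sum_nonneg nonneg) auto
  have "{1..N} = {1..l} \<union> {Suc l..N}" using assms by auto
  then have "(\<Sum>j\<in>{1..N}. B i j) = (\<Sum>j\<in>{1..l}. B i j) + (\<Sum>j\<in>{Suc l..N}. B i j)"
    by (simp add: sum.union_disjoint)
  then show s: "(\<Sum>j\<in>{1..l}. B i j) + (\<Sum>j\<in>{Suc l..N}. B i j) = 1"
    using rowsum[OF assms(2)] by simp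
  have "0 \<le> (\<Sum>j\<in>{Suc l..N}. B i j)"
    using assms by (intro sum_nonneg nonneg) auto
  with s show "(\<Sum>j\<in>{1..l}. B i j) \<le> 1" by simp
  show "(\<Sum>j\<in>{1..l}. B i j) \<le> 1 - \<delta>" if "l < i"
  proof -
    have "B i i \<le> (\<Sum>j\<in>{Suc l..N}. B i j)"
      using assms that by (intro member_le_sum nonneg) auto
    with s diag[OF assms(2)] show ?thesis by simp
  qed
qed

text \<open>The weight c_l of the overview. Only the upward direction through the cut gets a name,
  because \<open>balanced\<close> bounds the downward one by \<open>C\<close> times it.\<close>

definition cut_flow :: "nat \<Rightarrow> real" where
  "cut_flow l = (\<Sum>i\<in>{1..l}. \<Sum>j\<in>{Suc l..N}. B i j)"

lemma cut_flow_nonneg: "l \<le> N \<Longrightarrow> 0 \<le> cut_flow l"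
  unfolding cut_flow_def by (intro sum_nonneg nonneg) auto

lemma cut_flow_reverse:
  assumes "l \<le> N"
  shows "(\<Sum>i\<in>{Suc l..N}. \<Sum>j\<in>{1..l}. B i j) \<le> C * cut_flow l"
proof -
  have "(\<Sum>i\<in>{Suc l..N}. \<Sum>j\<in>{1..l}. B i j) \<le> (\<Sum>i\<in>{Suc l..N}. \<Sum>j\<in>{1..l}. C * B j i)"
    using assms by (intro sum_mono balanced) auto
  also have "\<dots> = C * cut_flow l"
    unfolding cut_flow_def by (subst sum.swap) (simp add: sum_distrib_left)
  finally show ?thesis .
qed

text \<open>The left-hand side bounds the coefficient of the gap \<open>u (Suc l) - u l\<close> in the gain of \<open>F_p\<close>,
  \<open>p = card S\<close>: an element of \<open>S\<close> above the cut costs at least \<open>\<delta>\<close>, which pays for the missing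
  element below the cut that it replaces.\<close>

lemma cut_mass_bound:
  assumes S: "S \<subseteq> {1..N}" and l: "l \<le> N"
  shows "(if l = card S then \<delta> * cut_flow l else if l < card S then - C * cut_flow l else 0)
     \<le> real (min (card S) l) - (\<Sum>i\<in>S. \<Sum>j\<in>{1..l}. B i j)"
proof -
  define r where "r i = (\<Sum>j\<in>{1..l}. B i j)" for i
  have finS: "finite S" using S finite_subset by blast
  have r: "0 \<le> r i" "r i \<le> 1" "l < i \<Longrightarrow> r i \<le> 1 - \<delta>" if "i \<in> {1..N}" for i
    using low_mass[OF l that] by (auto simp: r_def)
  have flow: "cut_flow l = (\<Sum>i\<in>{1..l}. 1 - r i)"
    unfolding cut_flow_def r_def
  proof (rule sum.cong)
    fix i assume "i \<in> {1..l}"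
    then show "(\<Sum>j\<in>{Suc l..N}. B i j) = 1 - (\<Sum>j\<in>{1..l}. B i j)"
      using low_mass(2)[OF l, of i] l by auto
  qed simp
  have compl: "real (card S) - sum r S = (\<Sum>i\<in>S. 1 - r i)"
    by (simp add: sum_subtractf)
  consider "l = card S" | "l < card S" | "l > card S" by linarith
  then show ?thesis unfolding r_def[symmetric]
  proof cases
    case 1
    have cards: "card (S - {1..l}) = card ({1..l} - S)"
    proof -
      have "card (S - {1..l}) = card S - card (S \<inter> {1..l})"
        using finS by (simp add: card_Diff_subset_Int)
      moreover have "card ({1..l} - S) = card {1..l} - card ({1..l} \<inter> S)"
        by (simp add: card_Diff_subset_Int)
      ultimately show ?thesis using 1 by (simp add: Int_commute)
    qed
    have "\<delta> * cut_flow l = (\<Sum>i\<in>{1..l} \<inter> S. \<delta> * (1 - r i)) + (\<Sum>i\<in>{1..l} - S. \<delta> * (1 - r i))"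
      unfolding flow sum_distrib_left by (subst sum.Int_Diff[of _ _ S]) auto
    also have "(\<Sum>i\<in>{1..l} \<inter> S. \<delta> * (1 - r i)) \<le> (\<Sum>i\<in>{1..l} \<inter> S. 1 - r i)"
      using r(2) l \<delta> by (intro sum_mono mult_left_le_one_le) auto
    also have "(\<Sum>i\<in>{1..l} - S. \<delta> * (1 - r i)) \<le> (\<Sum>i\<in>{1..l} - S. \<delta>)"
      using r(1) l \<delta> by (intro sum_mono mult_left_le) auto
    also have "\<dots> = (\<Sum>i\<in>S - {1..l}. \<delta>)" using cards by simp
    also have "\<dots> \<le> (\<Sum>i\<in>S - {1..l}. 1 - r i)"
    proof (rule sum_mono)
      fix i assume "i \<in> S - {1..l}"
      then have "i \<in> {1..N}" "l < i" using S by auto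
      then show "\<delta> \<le> 1 - r i" using r(3) by force
    qed
    also have "(\<Sum>i\<in>{1..l} \<inter> S. 1 - r i) + (\<Sum>i\<in>S - {1..l}. 1 - r i) = (\<Sum>i\<in>S. 1 - r i)"
      using sum.Int_Diff[OF finS, of "\<lambda>i. 1 - r i" "{1..l}"] by (simp add: Int_commute)
    finally show "(if l = card S then \<delta> * cut_flow l else if l < card S then - C * cut_flow l else 0)
        \<le> real (min (card S) l) - sum r S"
      using 1 compl by simp
  next
    case 2
    have split: "{1..N} = {1..l} \<union> {Suc l..N}" using l by auto
    \<comment> \<open>Enlarging \<open>S\<close> to all rows is affordable here: rows up to
      \<open>l\<close> contribute at most \<open>l\<close>, and rows above it contribute only the
      reverse flow through the cut.\<close>
    have "sum r S \<le> sum r {1..N}"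
      using S r by (intro sum_mono2) auto
    also have "\<dots> = sum r {1..l} + sum r {Suc l..N}"
      by (subst split, subst sum.union_disjoint) auto
    also have "sum r {Suc l..N} \<le> C * cut_flow l"
      using cut_flow_reverse[OF l] by (simp add: r_def)
    also have "sum r {1..l} = real l - cut_flow l"
      by (simp add: flow sum_subtractf)
    finally show "(if l = card S then \<delta> * cut_flow l else if l < card S then - C * cut_flow l else 0)
        \<le> real (min (card S) l) - sum r S"
      using 2 cut_flow_nonneg[OF l] by simp
  next
    case 3
    have "0 \<le> (\<Sum>i\<in>S. 1 - r i)" using S r(2) by (intro sum_nonneg) auto
    with 3 compl show "(if l = card S then \<delta> * cut_flow l else if l < card S then - C * cut_flow l else 0)
        \<le> real (min (card S) l) - sum r S"
      by simp
  qed
qed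

text \<open>After averaging, the p smallest entries may sit at any positions, hence a bound for
  every \<open>S\<close> of size \<open>p\<close>. Both sums are rewritten by
  \<open>sum_by_gaps\<close>. Their \<open>u N\<close> terms cancel, since each carries total weight
  \<open>p\<close>, and \<open>cut_mass_bound\<close> compares the coefficients of each gap.\<close>

lemma subset_sum_gain:
  assumes mono: "\<And>l. l \<in> {1..<N} \<Longrightarrow> u l \<le> u (Suc l)"
    and S: "S \<subseteq> {1..N}" "card S = p" and p: "p \<in> {1..<N}"
  shows "(\<Sum>i\<in>{1..p}. u i) + \<delta> * ((u (Suc p) - u p) * cut_flow p)
      - C * (\<Sum>l\<in>{1..<p}. (u (Suc l) - u l) * cut_flow l)
    \<le> (\<Sum>i\<in>S. \<Sum>j\<in>{1..N}. B i j * u j)"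
proof -
  define g where "g l = u (Suc l) - u l" for l
  define gain where
    "gain l = (if l = p then \<delta> * cut_flow l else if l < p then - C * cut_flow l else 0)" for l
  have N: "1 \<le> N" using p by auto
  have "(\<Sum>i\<in>S. \<Sum>j\<in>{1..N}. B i j * u j) = (\<Sum>j\<in>{1..N}. (\<Sum>i\<in>S. B i j) * u j)"
    by (subst sum.swap) (simp add: sum_distrib_right)
  also have "\<dots> = u N * (\<Sum>j\<in>{1..N}. \<Sum>i\<in>S. B i j)
      - (\<Sum>l\<in>{1..<N}. g l * (\<Sum>j\<in>{1..l}. \<Sum>i\<in>S. B i j))"
    unfolding g_def by (rule sum_by_gaps[OF N])
  also have "(\<Sum>j\<in>{1..N}. \<Sum>i\<in>S. B i j) = (\<Sum>i\<in>S. \<Sum>j\<in>{1..N}. B i j)"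
    by (rule sum.swap)
  also have "\<dots> = (\<Sum>i\<in>S. 1)" using S rowsum by (intro sum.cong) auto
  also have "\<dots> = p" using S by simp
  finally have new: "(\<Sum>i\<in>S. \<Sum>j\<in>{1..N}. B i j * u j)
      = u N * p - (\<Sum>l\<in>{1..<N}. g l * (\<Sum>i\<in>S. \<Sum>j\<in>{1..l}. B i j))"
    by (subst (asm) (2) sum.swap) simp
  have indicator: "(\<Sum>j\<in>{1..m}. of_bool (j \<le> p) :: real) = min p m" for m
  proof -
    have "(\<Sum>j\<in>{1..m}. of_bool (j \<le> p) :: real) = (\<Sum>j\<in>{1..min p m}. 1)"
      by (rule sum.mono_neutral_cong_right) auto
    then show ?thesis by simp
  qed
  \<comment> \<open>The old prefix sum is read as a weighted sum with 0/1 weights, so that the same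
    summation by parts applies to it.\<close>
  have "(\<Sum>i\<in>{1..p}. u i) = (\<Sum>j\<in>{1..N}. of_bool (j \<le> p) * u j)"
    using p by (intro sum.mono_neutral_cong_left) auto
  also have "\<dots> = u N * p - (\<Sum>l\<in>{1..<N}. g l * min p l)"
    unfolding sum_by_gaps[OF N] indicator g_def using p by simp
  finally have old: "(\<Sum>i\<in>{1..p}. u i) = u N * p - (\<Sum>l\<in>{1..<N}. g l * min p l)" .
  have "\<delta> * (g p * cut_flow p) - C * (\<Sum>l\<in>{1..<p}. g l * cut_flow l) = (\<Sum>l\<in>{1..p}. g l * gain l)"
  proof -
    have "{1..p} = insert p {1..<p}" using p by auto
    then have "(\<Sum>l\<in>{1..p}. g l * gain l) = g p * gain p + (\<Sum>l\<in>{1..<p}. g l * gain l)"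
      by simp
    also have "(\<Sum>l\<in>{1..<p}. g l * gain l) = (\<Sum>l\<in>{1..<p}. - C * (g l * cut_flow l))"
      by (rule sum.cong) (auto simp: gain_def)
    finally show ?thesis by (simp add: gain_def sum_distrib_left sum_negf algebra_simps)
  qed
  also have "\<dots> = (\<Sum>l\<in>{1..<N}. g l * gain l)"
    using p by (intro sum.mono_neutral_left) (auto simp: gain_def)
  also have "\<dots> \<le> (\<Sum>l\<in>{1..<N}. g l * (real (min p l) - (\<Sum>i\<in>S. \<Sum>j\<in>{1..l}. B i j)))"
  proof (rule sum_mono)
    fix l assume l: "l \<in> {1..<N}"
    then have "gain l \<le> real (min p l) - (\<Sum>i\<in>S. \<Sum>j\<in>{1..l}. B i j)"
      using cut_mass_bound[OF S(1), of l, unfolded S(2)] unfolding gain_def by simp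
    then show "g l * gain l \<le> g l * (real (min p l) - (\<Sum>i\<in>S. \<Sum>j\<in>{1..l}. B i j))"
      using mono[OF l] by (intro mult_left_mono) (auto simp: g_def)
  qed
  finally show ?thesis
    unfolding new old g_def[symmetric] by (simp add: right_diff_distrib sum_subtractf)
qed

text \<open>A distance is the sum of the gaps separating its two indices. Exchanging the sums, gap
  \<open>l\<close> is counted once for each unit of flow through cut \<open>l\<close> in either
  direction, and the downward flow costs at most the factor \<open>C\<close>.\<close>

lemma dissipation_by_cuts:
  assumes mono: "\<And>l. l \<in> {1..<N} \<Longrightarrow> u l \<le> u (Suc l)"
  shows "(\<Sum>i\<in>{1..N}. \<Sum>j\<in>{1..N}. B i j * \<bar>u i - u j\<bar>)
    \<le> (1 + C) * (\<Sum>l\<in>{1..<N}. (u (Suc l) - u l) * cut_flow l)"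
proof -
  define g where "g l = u (Suc l) - u l" for l
  have g: "0 \<le> g l" if "l \<in> {1..<N}" for l using mono[OF that] by (simp add: g_def)
  have half: "\<bar>u i - u j\<bar> = (\<Sum>l\<in>{1..<N}. g l * of_bool (i \<le> l \<and> l < j))"
    if "i \<le> j" "i \<in> {1..N}" "j \<in> {1..N}" for i j
  proof -
    have "u j - u i = (\<Sum>l\<in>{i..<j}. g l)"
      unfolding g_def using sum_Suc_diff'[OF \<open>i \<le> j\<close>, of u] by simp
    also have "\<dots> = (\<Sum>l\<in>{1..<N}. g l * of_bool (i \<le> l \<and> l < j))"
      using that by (intro sum.mono_neutral_cong_left) auto
    finally have "u j - u i = (\<Sum>l\<in>{1..<N}. g l * of_bool (i \<le> l \<and> l < j))" .
    moreover have "0 \<le> (\<Sum>l\<in>{1..<N}. g l * of_bool (i \<le> l \<and> l < j))"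
      using g by (intro sum_nonneg) auto
    ultimately show ?thesis by linarith
  qed
  have "\<bar>u i - u j\<bar> = (\<Sum>l\<in>{1..<N}. g l * (of_bool (i \<le> l \<and> l < j) + of_bool (j \<le> l \<and> l < i)))"
    if "i \<in> {1..N}" "j \<in> {1..N}" for i j
  proof (cases "i \<le> j")
    case True
    have "(\<Sum>l\<in>{1..<N}. g l * of_bool (i \<le> l \<and> l < j))
      = (\<Sum>l\<in>{1..<N}. g l * (of_bool (i \<le> l \<and> l < j) + of_bool (j \<le> l \<and> l < i)))"
      using True by (intro sum.cong) auto
    then show ?thesis using half[OF True that] by simp
  next
    case False
    have "(\<Sum>l\<in>{1..<N}. g l * of_bool (j \<le> l \<and> l < i))
      = (\<Sum>l\<in>{1..<N}. g l * (of_bool (i \<le> l \<and> l < j) + of_bool (j \<le> l \<and> l < i)))"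
      using False by (intro sum.cong) auto
    then show ?thesis using half[of j i] False that by (simp add: abs_minus_commute)
  qed
  then have "(\<Sum>i\<in>{1..N}. \<Sum>j\<in>{1..N}. B i j * \<bar>u i - u j\<bar>)
    = (\<Sum>i\<in>{1..N}. \<Sum>j\<in>{1..N}. \<Sum>l\<in>{1..<N}. g l *
        (B i j * (of_bool (i \<le> l \<and> l < j) + of_bool (j \<le> l \<and> l < i))))"
    by (intro sum.cong refl) (simp add: sum_distrib_left mult.left_commute)
  also have "\<dots> = (\<Sum>l\<in>{1..<N}. g l * (\<Sum>i\<in>{1..N}. \<Sum>j\<in>{1..N}.
        B i j * (of_bool (i \<le> l \<and> l < j) + of_bool (j \<le> l \<and> l < i))))"
    by (subst sum.swap[of _ "{1..<N}"], subst sum.swap[of _ "{1..<N}"])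
      (simp add: sum_distrib_left)
  also have "\<dots> \<le> (\<Sum>l\<in>{1..<N}. g l * ((1 + C) * cut_flow l))"
  proof (rule sum_mono)
    fix l assume l: "l \<in> {1..<N}"
    have up: "(\<Sum>i\<in>{1..N}. \<Sum>j\<in>{1..N}. B i j * of_bool (i \<le> l \<and> l < j)) = cut_flow l"
    proof -
      have "(\<Sum>i\<in>{1..N}. \<Sum>j\<in>{1..N}. B i j * of_bool (i \<le> l \<and> l < j))
        = (\<Sum>i\<in>{1..l}. \<Sum>j\<in>{1..N}. B i j * of_bool (i \<le> l \<and> l < j))"
        using l by (intro sum.mono_neutral_right) auto
      also have "\<dots> = cut_flow l" unfolding cut_flow_def
        using l by (intro sum.cong refl sum.mono_neutral_cong_right) auto
      finally show ?thesis .
    qed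
    have down: "(\<Sum>i\<in>{1..N}. \<Sum>j\<in>{1..N}. B i j * of_bool (j \<le> l \<and> l < i)) \<le> C * cut_flow l"
    proof -
      have "(\<Sum>i\<in>{1..N}. \<Sum>j\<in>{1..N}. B i j * of_bool (j \<le> l \<and> l < i))
        = (\<Sum>i\<in>{Suc l..N}. \<Sum>j\<in>{1..N}. B i j * of_bool (j \<le> l \<and> l < i))"
        using l by (intro sum.mono_neutral_right) auto
      also have "\<dots> = (\<Sum>i\<in>{Suc l..N}. \<Sum>j\<in>{1..l}. B i j)"
        using l by (intro sum.cong refl sum.mono_neutral_cong_right) auto
      also have "\<dots> \<le> C * cut_flow l" using l by (intro cut_flow_reverse) auto
      finally show ?thesis .
    qed
    show "g l * (\<Sum>i\<in>{1..N}. \<Sum>j\<in>{1..N}.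
        B i j * (of_bool (i \<le> l \<and> l < j) + of_bool (j \<le> l \<and> l < i))) \<le> g l * ((1 + C) * cut_flow l)"
      using up down g[OF l]
      by (intro mult_left_mono) (simp_all add: distrib_left distrib_right sum.distrib)
  qed
  also have "\<dots> = (1 + C) * (\<Sum>l\<in>{1..<N}. g l * cut_flow l)"
    by (simp add: sum_distrib_left mult.left_commute)
  finally show ?thesis by (simp add: g_def)
qed

end

section \<open>Sorted enumerations and the growth of the potential\<close>

text \<open>Serves two purposes: sorting the entries of a vector, and making the indices of each
  block consecutive.\<close>

lemma ex_sorted_enumeration:
  fixes c :: "'s::finite \<Rightarrow> 'b::linorder"
  obtains \<sigma> where "bij_betw \<sigma> {1..CARD('s)} UNIV" "mono_on {1..CARD('s)} (c \<circ> \<sigma>)"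
proof -
  obtain ys :: "'s list" where ys: "set ys = UNIV" "distinct ys"
    using finite_distinct_list[OF finite_class.finite_UNIV] by auto
  define xs where "xs = sort_key c ys"
  have xs: "set xs = UNIV" "distinct xs" "sorted (map c xs)"
    using ys by (auto simp: xs_def)
  then have len: "length xs = CARD('s)" using distinct_card by metis
  \<comment> \<open>List positions start at 0, labels at 1.\<close>
  have "bij_betw (\<lambda>n. n - 1) {1..CARD('s)} {..<CARD('s)}"
    by (rule bij_betw_byWitness[where f' = Suc]) auto
  moreover have "bij_betw ((!) xs) {..<CARD('s)} UNIV"
    using bij_betw_nth[OF xs(2)] xs(1) len by auto
  ultimately have "bij_betw ((!) xs \<circ> (\<lambda>n. n - 1)) {1..CARD('s)} UNIV"
    by (rule bij_betw_trans)
  moreover have "mono_on {1..CARD('s)} (c \<circ> ((!) xs \<circ> (\<lambda>n. n - 1)))"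
  proof (rule mono_onI)
    fix m n assume "m \<in> {1..CARD('s)}" "n \<in> {1..CARD('s)}" "m \<le> n"
    then show "(c \<circ> ((!) xs \<circ> (\<lambda>n. n - 1))) m \<le> (c \<circ> ((!) xs \<circ> (\<lambda>n. n - 1))) n"
      using sorted_nth_mono[OF xs(3), of "m - 1" "n - 1"] len by auto
  qed
  ultimately show ?thesis using that by blast
qed

text \<open>\<open>smallest_sum p y\<close> is a minimum over a nonempty set only for \<open>p \<le> CARD('s)\<close>.\<close>

definition smallest_sum :: "nat \<Rightarrow> real^'s \<Rightarrow> real" where
  "smallest_sum p y = Min ((\<lambda>S. \<Sum>i\<in>S. y $ i) ` {S. card S = p})"

text \<open>The range stops below \<open>CARD('s)\<close> because the gain of the p-th term comes
  from the gap above the p-th entry, and the largest entry has none.\<close>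

definition potential :: "real \<Rightarrow> real^'s \<Rightarrow> real" where
  "potential q y = (\<Sum>p\<in>{1..<CARD('s)}. q ^ p * smallest_sum p y)"

lemma smallest_sum_le: "card S = p \<Longrightarrow> smallest_sum p y \<le> (\<Sum>i\<in>S. y $ i)"
  unfolding smallest_sum_def by (rule Min_le) simp_all

lemma le_smallest_sum:
  fixes y :: "real^'s"
  assumes "p \<le> CARD('s)" "\<And>S. card S = p \<Longrightarrow> x \<le> (\<Sum>i\<in>S. y $ i)"
  shows "x \<le> smallest_sum p y"
proof -
  obtain S :: "'s set" where "card S = p"
    using obtain_subset_with_card_n[OF assms(1)] by metis
  then show ?thesis unfolding smallest_sum_def
    using assms(2) by (subst Min_ge_iff) auto
qed

lemma geometric_tail_le:
  fixes q :: real
  assumes "0 < q" "q < 1"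
  shows "(\<Sum>p\<in>{Suc l..<N}. q ^ p) \<le> q ^ l * (q / (1 - q))"
proof (cases "Suc l \<le> N")
  case True
  then have "(1 - q) * (\<Sum>p\<in>{Suc l..<N}. q ^ p) = q ^ Suc l - q ^ N"
  proof (induction N rule: dec_induct)
    case (step N)
    then show ?case by (simp add: atLeastLessThanSuc distrib_left) (simp add: algebra_simps)
  qed simp
  also have "\<dots> \<le> q ^ Suc l" using assms by simp
  finally show ?thesis using assms by (simp add: field_simps)
qed (use assms in simp)

text \<open>The term \<open>t l\<close> is rewarded with \<open>\<delta> * q ^ l\<close> and charged
  \<open>C * q ^ p\<close> for each \<open>p\<close> above \<open>l\<close>. The choice of
  \<open>q\<close> makes \<open>C * (q / (1 - q))\<close> equal to \<open>\<delta> / 2\<close>, so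
  the charges use up at most half of the reward. The remaining factor \<open>q ^ l\<close> is then
  lowered to \<open>q ^ N\<close>.\<close>

lemma weighted_gain:
  fixes t :: "nat \<Rightarrow> real"
  assumes t: "\<And>l. l \<in> {1..<N} \<Longrightarrow> 0 \<le> t l" and \<delta>: "0 < \<delta>" and C: "0 < C"
    and q: "q = \<delta> / (\<delta> + 2 * C)"
  shows "\<delta> / 2 * q ^ N * (\<Sum>l\<in>{1..<N}. t l)
    \<le> (\<Sum>p\<in>{1..<N}. q ^ p * (\<delta> * t p - C * (\<Sum>l\<in>{1..<p}. t l)))"
proof -
  have q01: "0 < q" "q < 1" and ratio: "C * (q / (1 - q)) = \<delta> / 2"
  proof -
    have "1 - q = 2 * C / (\<delta> + 2 * C)" using \<delta> C by (simp add: q field_simps)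
    then show "0 < q" "q < 1" "C * (q / (1 - q)) = \<delta> / 2"
      using \<delta> C by (auto simp: q)
  qed
  have "(\<Sum>p\<in>{1..<N}. q ^ p * (\<Sum>l\<in>{1..<p}. t l))
    = (\<Sum>p\<in>{1..<N}. \<Sum>l\<in>{1..<N}. if l < p then q ^ p * t l else 0)"
    unfolding sum_distrib_left by (intro sum.cong refl sum.mono_neutral_cong_left) auto
  also have "\<dots> = (\<Sum>l\<in>{1..<N}. \<Sum>p\<in>{1..<N}. if l < p then q ^ p * t l else 0)"
    by (rule sum.swap)
  also have "\<dots> = (\<Sum>l\<in>{1..<N}. (\<Sum>p\<in>{Suc l..<N}. q ^ p) * t l)"
    unfolding sum_distrib_right by (intro sum.cong refl sum.mono_neutral_cong_right) auto
  also have "\<dots> \<le> (\<Sum>l\<in>{1..<N}. q ^ l * (q / (1 - q)) * t l)"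
    using t geometric_tail_le[OF q01] by (intro sum_mono mult_right_mono) auto
  finally have "C * (\<Sum>p\<in>{1..<N}. q ^ p * (\<Sum>l\<in>{1..<p}. t l))
      \<le> C * (\<Sum>l\<in>{1..<N}. q ^ l * (q / (1 - q)) * t l)"
    using C by simp
  also have "\<dots> = (\<Sum>l\<in>{1..<N}. (C * (q / (1 - q))) * (q ^ l * t l))"
    by (simp add: sum_distrib_left ac_simps)
  also have "\<dots> = \<delta> / 2 * (\<Sum>l\<in>{1..<N}. q ^ l * t l)"
    unfolding ratio sum_distrib_left ..
  finally have loss: "C * (\<Sum>p\<in>{1..<N}. q ^ p * (\<Sum>l\<in>{1..<p}. t l))
      \<le> \<delta> / 2 * (\<Sum>l\<in>{1..<N}. q ^ l * t l)" .
  have "\<delta> / 2 * q ^ N * (\<Sum>l\<in>{1..<N}. t l) = \<delta> / 2 * (\<Sum>l\<in>{1..<N}. q ^ N * t l)"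
    by (simp add: sum_distrib_left mult.assoc)
  also have "\<dots> \<le> \<delta> / 2 * (\<Sum>l\<in>{1..<N}. q ^ l * t l)"
    using t q01 \<delta> by (intro mult_left_mono sum_mono mult_right_mono power_decreasing) auto
  also have "\<dots> \<le> \<delta> * (\<Sum>l\<in>{1..<N}. q ^ l * t l)
      - C * (\<Sum>p\<in>{1..<N}. q ^ p * (\<Sum>l\<in>{1..<p}. t l))"
    using loss by (simp add: field_simps)
  also have "\<dots> = (\<Sum>p\<in>{1..<N}. q ^ p * (\<delta> * t p - C * (\<Sum>l\<in>{1..<p}. t l)))"
    by (simp add: right_diff_distrib sum_subtractf sum_distrib_left ac_simps)
  finally show ?thesis .
qed

text \<open>Renumbering by the order of \<open>y\<close> makes the cut estimates applicable. Both
  the dissipation and the growth of the potential are compared with the sum of the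
  \<open>t l\<close>, gap times flow.\<close>

lemma potential_increase:
  fixes A :: "real^'s^'s" and y :: "real^'s"
  assumes A: "row_stochastic A" and diag: "\<And>i. \<delta> \<le> A $ i $ i"
    and balanced: "\<And>i j. A $ i $ j \<le> C * A $ j $ i"
    and \<delta>: "0 < \<delta>" "\<delta> \<le> 1" and C: "0 < C" and q: "q = \<delta> / (\<delta> + 2 * C)"
  shows "\<delta> / 2 * q ^ CARD('s) / (1 + C) * (\<Sum>i\<in>UNIV. \<Sum>j\<in>UNIV. A $ i $ j * \<bar>y $ i - y $ j\<bar>)
    \<le> potential q (A *v y) - potential q y"
proof -
  define N where "N = CARD('s)"
  obtain \<sigma> where \<sigma>: "bij_betw \<sigma> {1..N} (UNIV :: 's set)" and "mono_on {1..N} (($) y \<circ> \<sigma>)"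
    unfolding N_def by (rule ex_sorted_enumeration)
  define u where "u = ($) y \<circ> \<sigma>"
  define B where "B i j = A $ \<sigma> i $ \<sigma> j" for i j
  have mono: "u l \<le> u (Suc l)" if "l \<in> {1..<N}" for l
    using monotone_onD[OF \<open>mono_on {1..N} (($) y \<circ> \<sigma>)\<close>, of l "Suc l"] that by (simp add: u_def)
  have reindex: "(\<Sum>j\<in>UNIV. h j) = (\<Sum>j\<in>{1..N}. h (\<sigma> j))" for h :: "'s \<Rightarrow> real"
    using sum.reindex_bij_betw[OF \<sigma>, of h] by simp
  have B: "\<And>i j. 0 \<le> B i j" "\<And>i. (\<Sum>j\<in>{1..N}. B i j) = 1"
    "\<And>i. \<delta> \<le> B i i" "\<And>i j. B i j \<le> C * B j i"
    using A diag balanced unfolding B_def row_stochastic_def reindex by auto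
  define t where "t l = (u (Suc l) - u l) * cut_flow B N l" for l
  have t: "0 \<le> t l" if "l \<in> {1..<N}" for l
  proof -
    have "0 \<le> cut_flow B N l"
      by (rule cut_flow_nonneg[of N B \<delta> C]) (use B \<delta> C that in auto)
    then show ?thesis using mono[OF that] by (simp add: t_def)
  qed
  have gain: "smallest_sum p y + (\<delta> * t p - C * (\<Sum>l\<in>{1..<p}. t l)) \<le> smallest_sum p (A *v y)"
    if p: "p \<in> {1..<N}" for p
  proof (rule le_smallest_sum)
    show "p \<le> CARD('s)" using p by (simp add: N_def)
  next
    fix S :: "'s set" assume S: "card S = p"
    \<comment> \<open>The positions of the elements of \<open>S\<close> in the sorted order. They
      need not be the lowest ones.\<close>
    define S' where "S' = {i \<in> {1..N}. \<sigma> i \<in> S}"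
    have inj: "inj_on \<sigma> {1..N}" and surj: "\<sigma> ` {1..N} = UNIV"
      using \<sigma> by (auto simp: bij_betw_def)
    have "\<sigma> ` S' = \<sigma> ` {1..N} \<inter> S" by (auto simp: S'_def)
    then have "\<sigma> ` S' = S" using surj by simp
    moreover have injS': "inj_on \<sigma> S'" using inj by (rule inj_on_subset) (auto simp: S'_def)
    ultimately have cardS': "card S' = p" using S card_image by metis
    have injp: "inj_on \<sigma> {1..p}" using inj by (rule inj_on_subset) (use p in auto)
    have "smallest_sum p y \<le> (\<Sum>i\<in>\<sigma> ` {1..p}. y $ i)"
      using injp by (intro smallest_sum_le) (simp add: card_image)
    also have "\<dots> = (\<Sum>i\<in>{1..p}. u i)" using injp by (simp add: sum.reindex u_def)
    finally have "smallest_sum p y + (\<delta> * t p - C * (\<Sum>l\<in>{1..<p}. t l))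
      \<le> (\<Sum>i\<in>{1..p}. u i) + \<delta> * t p - C * (\<Sum>l\<in>{1..<p}. t l)" by simp
    also have "\<dots> \<le> (\<Sum>i\<in>S'. \<Sum>j\<in>{1..N}. B i j * u j)"
      unfolding t_def
      by (rule subset_sum_gain[where N = N and B = B and u = u, OF B(1-4) \<delta> C mono _ cardS' p]) (auto simp: S'_def)
    also have "\<dots> = (\<Sum>i\<in>S'. (A *v y) $ \<sigma> i)"
      by (simp add: matrix_vector_mult_def reindex B_def u_def)
    also have "\<dots> = (\<Sum>i\<in>S. (A *v y) $ i)"
      using sum.reindex[OF injS', of "($) (A *v y)"] \<open>\<sigma> ` S' = S\<close> by simp
    finally show "smallest_sum p y + (\<delta> * t p - C * (\<Sum>l\<in>{1..<p}. t l)) \<le> (\<Sum>i\<in>S. (A *v y) $ i)" .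
  qed
  have q0: "0 < q" using \<delta> C by (simp add: q)
  have "(\<Sum>i\<in>UNIV. \<Sum>j\<in>UNIV. A $ i $ j * \<bar>y $ i - y $ j\<bar>)
    = (\<Sum>i\<in>{1..N}. \<Sum>j\<in>{1..N}. B i j * \<bar>u i - u j\<bar>)"
    by (simp add: reindex B_def u_def)
  also have "\<dots> \<le> (1 + C) * (\<Sum>l\<in>{1..<N}. t l)"
    unfolding t_def
    by (rule dissipation_by_cuts[where N = N and B = B and u = u, OF B(1-4) \<delta> C mono])
  finally have "\<delta> / 2 * q ^ N / (1 + C) * (\<Sum>i\<in>UNIV. \<Sum>j\<in>UNIV. A $ i $ j * \<bar>y $ i - y $ j\<bar>)
    \<le> \<delta> / 2 * q ^ N / (1 + C) * ((1 + C) * (\<Sum>l\<in>{1..<N}. t l))"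
    using \<delta> C q0 by (intro mult_left_mono) auto
  also have "\<dots> = \<delta> / 2 * q ^ N * (\<Sum>l\<in>{1..<N}. t l)"
    using C by (simp add: divide_simps)
  also have "\<dots> \<le> (\<Sum>p\<in>{1..<N}. q ^ p * (\<delta> * t p - C * (\<Sum>l\<in>{1..<p}. t l)))"
    by (rule weighted_gain[OF t \<delta>(1) C q])
  also have "\<dots> \<le> (\<Sum>p\<in>{1..<N}. q ^ p * (smallest_sum p (A *v y) - smallest_sum p y))"
    using gain q0 by (intro sum_mono mult_left_mono) (auto simp: le_diff_eq add.commute)
  also have "\<dots> = potential q (A *v y) - potential q y"
    by (simp add: potential_def N_def right_diff_distrib sum_subtractf)
  finally show ?thesis by (simp add: N_def)
qed

lemma potential_le:
  fixes y :: "real^'s" and q M :: real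
  assumes "0 < q" and "\<And>i. y $ i \<le> M" "0 \<le> M"
  shows "potential q y \<le> (\<Sum>p\<in>{1..<CARD('s)}. q ^ p * (p * M))"
  unfolding potential_def
proof (intro sum_mono mult_left_mono)
  fix p assume "p \<in> {1..<CARD('s)}"
  then obtain S :: "'s set" where S: "card S = p"
    using obtain_subset_with_card_n[of p "UNIV :: 's set"] by auto
  have "smallest_sum p y \<le> (\<Sum>i\<in>S. y $ i)" by (rule smallest_sum_le[OF S])
  also have "\<dots> \<le> (\<Sum>i\<in>S. M)" by (intro sum_mono assms)
  finally show "smallest_sum p y \<le> p * M" using S by simp
qed (use assms in simp)

section \<open>Solutions of a balanced chain and their limits\<close>

lemma row_stochastic_average_bounds:
  assumes "row_stochastic A" "\<And>i. a \<le> y $ i" "\<And>i. y $ i \<le> b"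
  shows "a \<le> (A *v y) $ i" "(A *v y) $ i \<le> b"
proof -
  have nn: "0 \<le> A $ i $ j" and row: "(\<Sum>j\<in>UNIV. A $ i $ j) = 1" for j
    using assms(1) by (auto simp: row_stochastic_def)
  have "a = (\<Sum>j\<in>UNIV. A $ i $ j * a)" by (simp flip: sum_distrib_right add: row)
  also have "\<dots> \<le> (A *v y) $ i"
    unfolding matrix_vector_mult_def using nn assms(2) by (auto intro!: sum_mono mult_left_mono)
  finally show "a \<le> (A *v y) $ i" .
  have "(A *v y) $ i \<le> (\<Sum>j\<in>UNIV. A $ i $ j * b)"
    unfolding matrix_vector_mult_def using nn assms(3) by (auto intro!: sum_mono mult_left_mono)
  also have "\<dots> = b" by (simp flip: sum_distrib_right add: row)
  finally show "(A *v y) $ i \<le> b" .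
qed

context
  fixes A :: "nat \<Rightarrow> real^'s^'s" and \<delta> C :: real
  assumes stochastic: "\<And>n. row_stochastic (A n)"
    and diag: "\<And>n i. \<delta> \<le> A n $ i $ i"
    and balanced: "\<And>n i j. A n $ i $ j \<le> C * A n $ j $ i"
    and \<delta>: "0 < \<delta>" "\<delta> \<le> 1" and C: "0 < C"
begin

lemma entry_nonneg: "0 \<le> A n $ i $ j"
  using stochastic by (auto simp: row_stochastic_def)

lemma solution_bounds:
  assumes sol: "\<And>n. k \<le> n \<Longrightarrow> y (Suc n) = A n *v y n"
    and "\<And>i. a \<le> y k $ i" "\<And>i. y k $ i \<le> b" and "k \<le> n"
  shows "a \<le> y n $ i \<and> y n $ i \<le> b"
  using \<open>k \<le> n\<close>
proof (induction n arbitrary: i rule: dec_induct)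
  case base
  then show ?case using assms by simp
next
  case (step n)
  then show ?case
    using row_stochastic_average_bounds[OF stochastic, of a "y n" b] sol[of n] by auto
qed

text \<open>Each step raises the potential by at least \<open>\<kappa>\<close> times the
  dissipation. The solution stays within its initial bounds, so the potential is bounded above and
  the telescoped increments have bounded partial sums.\<close>

lemma summable_dissipation:
  assumes sol: "\<And>n. k \<le> n \<Longrightarrow> y (Suc n) = A n *v y n"
  shows "summable (\<lambda>n. \<Sum>i\<in>UNIV. \<Sum>j\<in>UNIV. A n $ i $ j * \<bar>y n $ i - y n $ j\<bar>)"
proof -
  define D where "D n = (\<Sum>i\<in>UNIV. \<Sum>j\<in>UNIV. A n $ i $ j * \<bar>y n $ i - y n $ j\<bar>)" for n
  define q where "q = \<delta> / (\<delta> + 2 * C)"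
  define \<kappa> where "\<kappa> = \<delta> / 2 * q ^ CARD('s) / (1 + C)"
  have q: "0 < q" and \<kappa>: "0 < \<kappa>" using \<delta> C by (auto simp: q_def \<kappa>_def)
  define M where "M = Max (range (\<lambda>i. \<bar>y k $ i\<bar>))"
  have M: "\<bar>y k $ i\<bar> \<le> M" for i unfolding M_def by (intro Max_ge) auto
  have M': "- M \<le> y k $ i" "y k $ i \<le> M" for i using M[of i] by auto
  have "0 \<le> M" using M[of undefined] by linarith
  define U where "U = (\<Sum>p\<in>{1..<CARD('s)}. q ^ p * (p * M))"
  have U: "potential q (y n) \<le> U" if "k \<le> n" for n
    unfolding U_def using solution_bounds[OF sol M' that] q \<open>0 \<le> M\<close> by (intro potential_le) auto
  have partial: "\<kappa> * (\<Sum>m<n. D (m + k)) \<le> potential q (y (n + k)) - potential q (y k)" for n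
  proof (induction n)
    case (Suc n)
    have "\<kappa> * D (n + k) \<le> potential q (y (Suc n + k)) - potential q (y (n + k))"
      using potential_increase[OF stochastic diag balanced \<delta> C q_def, of "n + k" "y (n + k)"] sol[of "n + k"]
      by (simp add: D_def \<kappa>_def)
    with Suc.IH show ?case by (simp add: distrib_left)
  qed simp
  \<comment> \<open>Before instant \<open>k\<close> nothing is known about \<open>y\<close>, so
    summability is proved for the shifted series and transferred back.\<close>
  have "summable (\<lambda>m. D (m + k))"
  proof (rule summableI_nonneg_bounded)
    show "0 \<le> D (n + k)" for n
      unfolding D_def by (intro sum_nonneg mult_nonneg_nonneg entry_nonneg) auto
    show "(\<Sum>m<n. D (m + k)) \<le> (U - potential q (y k)) / \<kappa>" for n
      using partial[of n] U[of "n + k"] \<kappa> by (simp add: field_simps)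
  qed
  then show ?thesis using summable_iff_shift[of D k] unfolding D_def by blast
qed

lemma summable_edge_dissipation:
  assumes sol: "\<And>n. k \<le> n \<Longrightarrow> y (Suc n) = A n *v y n"
  shows "summable (\<lambda>n. A n $ i $ j * \<bar>y n $ i - y n $ j\<bar>)"
proof (rule summable_comparison_test'[OF summable_dissipation[of k y]])
  show "norm (A n $ i $ j * \<bar>y n $ i - y n $ j\<bar>)
      \<le> (\<Sum>i\<in>UNIV. \<Sum>j\<in>UNIV. A n $ i $ j * \<bar>y n $ i - y n $ j\<bar>)" for n
  proof -
    have "A n $ i $ j * \<bar>y n $ i - y n $ j\<bar> \<le> (\<Sum>j\<in>UNIV. A n $ i $ j * \<bar>y n $ i - y n $ j\<bar>)"
      by (rule member_le_sum) (auto intro: mult_nonneg_nonneg entry_nonneg)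
    also have "\<dots> \<le> (\<Sum>i\<in>UNIV. \<Sum>j\<in>UNIV. A n $ i $ j * \<bar>y n $ i - y n $ j\<bar>)"
      by (rule member_le_sum[of i UNIV "\<lambda>i. \<Sum>j\<in>UNIV. A n $ i $ j * \<bar>y n $ i - y n $ j\<bar>"])
        (auto intro!: sum_nonneg mult_nonneg_nonneg entry_nonneg)
    finally show ?thesis using entry_nonneg by (simp add: abs_mult)
  qed
qed (rule sol)

text \<open>As rows sum to 1, an increment of \<open>y\<close> at \<open>i\<close> is a weighted sum
  of differences to the other entries. The dissipation dominates it, so the increments are
  absolutely summable.\<close>

lemma solution_convergent:
  assumes sol: "\<And>n. k \<le> n \<Longrightarrow> y (Suc n) = A n *v y n"
  shows "convergent (\<lambda>n. y n $ i)"
proof -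
  have "summable (\<lambda>n. \<Sum>j\<in>UNIV. A n $ i $ j * \<bar>y n $ i - y n $ j\<bar>)"
    by (intro summable_sum summable_edge_dissipation sol)
  then have "summable (\<lambda>n. y (Suc n) $ i - y n $ i)"
  proof (rule summable_comparison_test')
    fix n assume "k \<le> n"
    have row: "(\<Sum>j\<in>UNIV. A n $ i $ j) = 1"
      using stochastic by (auto simp: row_stochastic_def)
    have "y (Suc n) $ i - y n $ i = (\<Sum>j\<in>UNIV. A n $ i $ j * y n $ j) - (\<Sum>j\<in>UNIV. A n $ i $ j) * y n $ i"
      using sol[OF \<open>k \<le> n\<close>] by (simp add: matrix_vector_mult_def row)
    also have "\<dots> = (\<Sum>j\<in>UNIV. A n $ i $ j * (y n $ j - y n $ i))"
      by (simp add: sum_distrib_right right_diff_distrib sum_subtractf)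
    also have "norm \<dots> \<le> (\<Sum>j\<in>UNIV. norm (A n $ i $ j * (y n $ j - y n $ i)))"
      by (rule norm_sum)
    also have "\<dots> = (\<Sum>j\<in>UNIV. A n $ i $ j * \<bar>y n $ i - y n $ j\<bar>)"
      using entry_nonneg by (simp add: abs_mult abs_minus_commute)
    finally show "norm (y (Suc n) $ i - y n $ i) \<le> (\<Sum>j\<in>UNIV. A n $ i $ j * \<bar>y n $ i - y n $ j\<bar>)" .
  qed
  then have "convergent (\<lambda>n. \<Sum>m<n. y (Suc m) $ i - y m $ i)"
    by (simp add: summable_iff_convergent)
  then have "convergent (\<lambda>n. y n $ i - y 0 $ i)"
    by (simp only: sum_lessThan_telescope[of "\<lambda>n. y n $ i"])
  then show ?thesis
    using convergent_add[OF _ convergent_const[of "y 0 $ i"]] by fastforce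
qed

text \<open>If the limits differed, the two entries would eventually stay more than \<open>e\<close>
  apart, and the weights would be dominated by the summable edge dissipation divided by
  \<open>e\<close>.\<close>

lemma equal_limits_of_infinite_flow:
  assumes sol: "\<And>n. k \<le> n \<Longrightarrow> y (Suc n) = A n *v y n"
    and lim: "(\<lambda>n. y n $ i) \<longlonglongrightarrow> a" "(\<lambda>n. y n $ j) \<longlonglongrightarrow> b"
    and flow: "\<not> summable (\<lambda>n. A n $ i $ j)"
  shows "a = b"
proof (rule ccontr)
  assume "a \<noteq> b"
  define e where "e = \<bar>a - b\<bar> / 2"
  have e: "0 < e" "e < \<bar>a - b\<bar>" using \<open>a \<noteq> b\<close> by (auto simp: e_def)
  have "(\<lambda>n. \<bar>y n $ i - y n $ j\<bar>) \<longlonglongrightarrow> \<bar>a - b\<bar>"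
    by (intro tendsto_intros lim)
  then have "\<forall>\<^sub>F n in sequentially. e < \<bar>y n $ i - y n $ j\<bar>"
    using e(2) by (rule order_tendstoD)
  then have "\<forall>\<^sub>F n in sequentially. norm (A n $ i $ j) \<le> A n $ i $ j * \<bar>y n $ i - y n $ j\<bar> / e"
  proof eventually_elim
    case (elim n)
    then have "A n $ i $ j * e \<le> A n $ i $ j * \<bar>y n $ i - y n $ j\<bar>"
      using entry_nonneg by (intro mult_left_mono) auto
    then show ?case using e entry_nonneg by (simp add: pos_le_divide_eq)
  qed
  then have "summable (\<lambda>n. A n $ i $ j)"
    by (rule summable_comparison_test_ev)
      (intro summable_divide summable_edge_dissipation sol)
  with flow show False ..
qed

section \<open>Backward products and class-ergodicity\<close>

text \<open>Each column is a solution started from a unit vector at instant \<open>k\<close>, so the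
  results on solutions carry over to the products.\<close>

lemma backward_product_column:
  assumes "k \<le> n"
  shows "column j (backward_product A (Suc n) k) = A n *v column j (backward_product A n k)"
  using assms by (simp add: column_def vec_eq_iff matrix_matrix_mult_def matrix_vector_mult_def)

lemma backward_product_self [simp]: "backward_product A k k = mat 1"
  by (cases k) auto

lemma backward_product_bounds:
  assumes "k \<le> n"
  shows "0 \<le> backward_product A n k $ i $ j" "backward_product A n k $ i $ j \<le> 1"
proof -
  have "0 \<le> column j (backward_product A n k) $ i \<and> column j (backward_product A n k) $ i \<le> 1"
    by (rule solution_bounds[where y = "\<lambda>n. column j (backward_product A n k)"])
      (use assms in \<open>simp_all add: backward_product_column del: backward_product.simps\<close>,
        simp_all add: column_def mat_def)
  then show "0 \<le> backward_product A n k $ i $ j" "backward_product A n k $ i $ j \<le> 1"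
    by (auto simp: column_def)
qed

text \<open>Weight can pass from \<open>K\<close> to an index outside only by leaving
  \<open>K\<close> at some instant, and instant \<open>m\<close> lets out at most
  \<open>\<epsilon> m\<close> in total. The induction peels off the leftmost factor.\<close>

lemma backward_product_outside:
  assumes "\<And>n. (\<Sum>x\<in>K. \<Sum>z\<in>- K. A n $ x $ z) = \<epsilon> n" and "x \<in> K" "j \<notin> K" "k \<le> n"
  shows "backward_product A n k $ x $ j \<le> (\<Sum>m\<in>{k..<n}. \<epsilon> m)"
  using \<open>k \<le> n\<close> \<open>x \<in> K\<close>
proof (induction n arbitrary: x rule: dec_induct)
  case base
  then show ?case using \<open>j \<notin> K\<close> by (auto simp: mat_def)
next
  case (step n)
  define P where "P z = backward_product A n k $ z $ j" for z
  define E where "E = (\<Sum>m\<in>{k..<n}. \<epsilon> m)"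
  have E: "0 \<le> E" unfolding E_def assms(1)[symmetric] by (intro sum_nonneg entry_nonneg)
  have "backward_product A (Suc n) k $ x $ j = (\<Sum>z\<in>UNIV. A n $ x $ z * P z)"
    using step.hyps by (simp add: matrix_matrix_mult_def P_def)
  also have "\<dots> = (\<Sum>z\<in>K. A n $ x $ z * P z) + (\<Sum>z\<in>- K. A n $ x $ z * P z)"
    by (subst sum.union_disjoint[symmetric]) auto
  \<comment> \<open>Inside \<open>K\<close> the induction hypothesis is averaged with total weight
    at most 1. Outside, entries of the product are at most 1, which leaves the weight crossing at
    instant \<open>n\<close>.\<close>
  also have "(\<Sum>z\<in>K. A n $ x $ z * P z) \<le> (\<Sum>z\<in>K. A n $ x $ z * E)"
    using step.IH entry_nonneg by (intro sum_mono mult_left_mono) (auto simp: P_def E_def)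
  also have "\<dots> \<le> (\<Sum>z\<in>UNIV. A n $ x $ z * E)"
    using E entry_nonneg by (intro sum_mono2) auto
  also have "\<dots> = E"
    using stochastic[of n] by (simp flip: sum_distrib_right add: row_stochastic_def)
  also have "(\<Sum>z\<in>- K. A n $ x $ z * P z) \<le> (\<Sum>z\<in>- K. A n $ x $ z)"
    using backward_product_bounds[OF step.hyps(1)] entry_nonneg
    by (intro sum_mono mult_left_le) (auto simp: P_def)
  also have "\<dots> \<le> \<epsilon> n"
    unfolding assms(1)[symmetric] using step.prems entry_nonneg
    by (intro member_le_sum[of x K "\<lambda>x. \<Sum>z\<in>- K. A n $ x $ z"]) (auto intro: sum_nonneg)
  finally show ?case using step.hyps by (simp add: E_def)
qed

text \<open>The weights leaving \<open>K\<close> form a convergent series, and its tail from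
  \<open>k\<close> on bounds the limiting entry.\<close>

lemma limit_outside_tendsto_0:
  assumes L: "\<And>k. (\<lambda>n. backward_product A n k) \<longlonglongrightarrow> L k"
    and summable: "\<And>x z. x \<in> K \<Longrightarrow> z \<notin> K \<Longrightarrow> summable (\<lambda>n. A n $ x $ z)"
    and "i \<in> K" "j \<notin> K"
  shows "(\<lambda>k. L k $ i $ j) \<longlonglongrightarrow> 0"
proof -
  define \<epsilon> where "\<epsilon> n = (\<Sum>x\<in>K. \<Sum>z\<in>- K. A n $ x $ z)" for n
  have \<epsilon>: "summable \<epsilon>" unfolding \<epsilon>_def by (intro summable_sum summable) auto
  have \<epsilon>_nonneg: "0 \<le> \<epsilon> n" for n unfolding \<epsilon>_def by (intro sum_nonneg entry_nonneg)
  have entry: "(\<lambda>n. backward_product A n k $ i $ j) \<longlonglongrightarrow> L k $ i $ j" for k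
    by (intro tendsto_vec_nth L)
  have lower: "0 \<le> L k $ i $ j" for k
    by (rule LIMSEQ_le_const[OF entry]) (use backward_product_bounds in blast)
  have upper: "L k $ i $ j \<le> (\<Sum>m. \<epsilon> (m + k))" for k
  proof (rule LIMSEQ_le_const2[OF entry], intro exI allI impI)
    fix n assume "k \<le> n"
    then have "backward_product A n k $ i $ j \<le> (\<Sum>m\<in>{k..<n}. \<epsilon> m)"
      using backward_product_outside[of K \<epsilon>] assms(3,4) by (simp add: \<epsilon>_def)
    also have "\<dots> = (\<Sum>m<n - k. \<epsilon> (m + k))"
      using \<open>k \<le> n\<close> sum.shift_bounds_nat_ivl[of \<epsilon> 0 k "n - k"] by (simp add: atLeast0LessThan)
    also have "\<dots> \<le> (\<Sum>m. \<epsilon> (m + k))"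
      by (rule sum_le_suminf) (use \<epsilon> \<epsilon>_nonneg in \<open>auto simp: summable_iff_shift\<close>)
    finally show "backward_product A n k $ i $ j \<le> (\<Sum>m. \<epsilon> (m + k))" .
  qed
  have tail: "(\<lambda>k. \<Sum>m. \<epsilon> (m + k)) \<longlonglongrightarrow> 0"
    by (rule suminf_exist_split2[OF \<epsilon>])
  show ?thesis
    by (rule tendsto_sandwich[OF always_eventually always_eventually tendsto_const tail])
      (intro allI lower upper)+
qed

lemma ex_limit_backward_product: "\<exists>M. (\<lambda>n. backward_product A n k) \<longlonglongrightarrow> M"
proof -
  have "convergent (\<lambda>n. column j (backward_product A n k) $ i)" for i j
    by (rule solution_convergent[of k "\<lambda>n. column j (backward_product A n k)"])
      (rule backward_product_column)
  then have "\<exists>x. (\<lambda>n. backward_product A n k $ i $ j) \<longlonglongrightarrow> x" for i j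
    by (auto simp: column_def convergent_def)
  then obtain M where "\<And>i j. (\<lambda>n. backward_product A n k $ i $ j) \<longlonglongrightarrow> M i j"
    by metis
  then have "(\<lambda>n. backward_product A n k) \<longlonglongrightarrow> (\<chi> i j. M i j)"
    by (intro vec_tendstoI) simp
  then show ?thesis ..
qed

theorem balanced_chain_class_ergodic: "class_ergodic A"
proof -
  obtain L where L: "\<And>k. (\<lambda>n. backward_product A n k) \<longlonglongrightarrow> L k"
    using ex_limit_backward_product by metis
  have entry: "(\<lambda>n. column j (backward_product A n k) $ i) \<longlonglongrightarrow> L k $ i $ j" for k i j
    by (simp add: column_def tendsto_vec_nth L)
  have same_rows: "L k $ i = L k $ j" if "\<not> summable (\<lambda>n. A n $ i $ j)" for i j k
  proof (subst vec_eq_iff, rule allI)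
    fix z
    show "L k $ i $ z = L k $ j $ z"
      by (rule equal_limits_of_infinite_flow[where y = "\<lambda>n. column z (backward_product A n k)",
            OF backward_product_column entry entry that])
  qed
  \<comment> \<open>A block is determined by the whole family of limiting rows of its indices. There
    are finitely many such families, so they can be coded injectively by natural numbers, which
    supplies ordered block labels.\<close>
  obtain h :: "(nat \<Rightarrow> real^'s) \<Rightarrow> nat" where h: "inj_on h (range (\<lambda>i k. L k $ i))"
    using finite_imp_inj_to_nat_seg[of "range (\<lambda>i k. L k $ i)"] by auto
  define c where "c i = h (\<lambda>k. L k $ i)" for i
  have c: "c i = c j \<longleftrightarrow> (\<forall>k. L k $ i = L k $ j)" for i j
    by (simp add: c_def inj_on_eq_iff[OF h rangeI rangeI] fun_eq_iff)
  have outside: "(\<lambda>k. L k $ i $ j) \<longlonglongrightarrow> 0" if "c i \<noteq> c j" for i j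
  \<comment> \<open>By the contrapositive of \<open>same_rows\<close>, every edge between indices of
    different labels has summable weight.\<close>
  proof (rule limit_outside_tendsto_0[OF L, where K = "{x. c x = c i}"])
    show "summable (\<lambda>n. A n $ x $ z)" if "x \<in> {x. c x = c i}" "z \<notin> {x. c x = c i}" for x z
      using same_rows[of x z] that c by (metis mem_Collect_eq)
  qed (use that in auto)
  obtain \<sigma> where "bij_betw \<sigma> {1..CARD('s)} UNIV" "mono_on {1..CARD('s)} (c \<circ> \<sigma>)"
    by (rule ex_sorted_enumeration)
  then show ?thesis
    unfolding class_ergodic_def using stochastic L c outside
    by (intro conjI allI exI[of _ L] exI[of _ \<sigma>] exI[of _ "c \<circ> \<sigma>"]) auto
qed

theorem balanced_chain_consensus: "unconditional_multiple_consensus A"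
  unfolding unconditional_multiple_consensus_def using solution_convergent by blast

end

section \<open>State-dependent transition matrices\<close>

text \<open>The numerators are symmetric in \<open>i\<close> and \<open>j\<close>, so opposite
  entries differ only through their normalising sums \<open>Z\<close>, which all lie between
  \<open>f 0\<close> and \<open>CARD('s) * f 0\<close>.\<close>

lemma transition_matrix_properties:
  fixes f :: "real \<Rightarrow> real" and x :: "real^'s"
  assumes nonneg: "\<And>x. 0 \<le> x \<Longrightarrow> 0 \<le> f x" and anti: "antimono_on {0..} f" and pos: "0 < f 0"
  shows "row_stochastic (transition_matrix f x)"
    and "1 / CARD('s) \<le> transition_matrix f x $ i $ i"
    and "transition_matrix f x $ i $ j \<le> CARD('s) * transition_matrix f x $ j $ i"
proof -
  define Z where "Z i = (\<Sum>k\<in>UNIV. f \<bar>x $ i - x $ k\<bar>)" for i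
  have le: "f \<bar>t\<bar> \<le> f 0" for t
    using monotone_onD[OF anti, of 0 "\<bar>t\<bar>"] by auto
  have Z_ge: "f 0 \<le> Z i" for i
  proof -
    have "f \<bar>x $ i - x $ i\<bar> \<le> Z i" unfolding Z_def
      using nonneg by (intro member_le_sum) auto
    then show ?thesis by simp
  qed
  then have Z_pos: "0 < Z i" for i using pos less_le_trans by blast
  have Z_le: "Z i \<le> CARD('s) * f 0" for i
    unfolding Z_def using sum_bounded_above[of UNIV "\<lambda>k. f \<bar>x $ i - x $ k\<bar>" "f 0"] le by simp
  have entry: "transition_matrix f x $ i $ j = f \<bar>x $ i - x $ j\<bar> / Z i" for i j
    by (simp add: transition_matrix_def Z_def)
  show "row_stochastic (transition_matrix f x)"
    unfolding row_stochastic_def entry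
  proof (intro conjI allI)
    show "0 \<le> f \<bar>x $ i - x $ j\<bar> / Z i" for i j
      using nonneg[of "\<bar>x $ i - x $ j\<bar>"] Z_pos[of i] by simp
    show "(\<Sum>j\<in>UNIV. f \<bar>x $ i - x $ j\<bar> / Z i) = 1" for i
      using Z_pos[of i] by (simp flip: sum_divide_distrib Z_def)
  qed
  show "1 / CARD('s) \<le> transition_matrix f x $ i $ i"
    using Z_le[of i] Z_pos[of i] by (simp add: entry field_simps)
  have "Z j \<le> CARD('s) * Z i"
    using Z_le[of j] mult_left_mono[OF Z_ge[of i], of "real CARD('s)"] by linarith
  then have "f \<bar>x $ i - x $ j\<bar> * Z j \<le> f \<bar>x $ i - x $ j\<bar> * (CARD('s) * Z i)"
    by (intro mult_left_mono nonneg) auto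
  then show "transition_matrix f x $ i $ j \<le> CARD('s) * transition_matrix f x $ j $ i"
    using Z_pos[of i] Z_pos[of j]
    unfolding entry abs_minus_commute[of "x $ j" "x $ i"] by (simp add: field_simps)
qed

theorem mainTheorem7:
  fixes R :: real and f :: "real \<Rightarrow> real" and X :: "nat \<Rightarrow> real^'s"
  assumes "R > 0"
    and "\<And>x. 0 \<le> x \<Longrightarrow> 0 \<le> f x"
    and "antimono_on {0..} f"
    and "\<And>x. 0 \<le> x \<Longrightarrow> x < R \<Longrightarrow> f x > 0"
    and "\<And>x. x \<ge> R \<Longrightarrow> f x = 0"
    and "evolves_from 0 f X"
  shows "class_ergodic (\<lambda>n. transition_matrix f (X n))
    \<and> unconditional_multiple_consensus (\<lambda>n. transition_matrix f (X n))
    \<and> (\<forall>n0 (Y :: nat \<Rightarrow> real^'s). evolves_from n0 f Y \<longrightarrow> (\<forall>i. convergent (\<lambda>n. Y n $ i)))"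
proof -
  have "0 < f 0" using assms(1,4) by simp
  note props = transition_matrix_properties[OF assms(2,3) this]
  have s: "0 < 1 / real CARD('s)" "1 / real CARD('s) \<le> 1" "0 < real CARD('s)"
    by (auto simp: Suc_le_eq)
  \<comment> \<open>The matrix properties hold at every state, so the sequence \<open>Y\<close> can
    be arbitrary. A trajectory is then a solution of the linear chain that it generates
    itself.\<close>
  have consensus: "unconditional_multiple_consensus (\<lambda>n. transition_matrix f (Y n))"
    for Y :: "nat \<Rightarrow> real^'s"
    by (rule balanced_chain_consensus[OF props s])
  have "convergent (\<lambda>n. Y n $ i)" if "evolves_from n0 f Y" for n0 i and Y :: "nat \<Rightarrow> real^'s"
  proof -
    have "\<forall>n\<ge>n0. Y (Suc n) = transition_matrix f (Y n) *v Y n"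
      using that by (simp add: evolves_from_def vec_eq_iff matrix_vector_mult_def)
    then show ?thesis
      using consensus[of Y] unfolding unconditional_multiple_consensus_def by blast
  qed
  then show ?thesis
    using balanced_chain_class_ergodic[OF props s] consensus by blast
qed

end
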